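(* Let $P \in \mathcal{C}(G_n)$, and let $k \in Q_n$. Then the following are equivalent: (1) The set $Q_n - \{k\}$ is separable with respect to $P$. (2) The $k^{th}$ column of $P$ is of the form $\vec{w} = \begin{pmatrix} 1 & 0 & 0 & 1 & 1 & \cdots & 0 & 0 & 1 \end{pmatrix}^\top$ or its bitwise complement. (3) The matrix $P$ is equal to $\mathrm{weave}_k^1(P_1)$ or $\mathrm{weave}_k^0(P_1)$ for some $P_1 \in \mathcal{C}(G_{n-1})$.
   Context: Let $Q_n=\{1,\dots,n\}$ be a set of $n$ yes/no questions; an outcome on $S\subseteq Q_n$ is an element of $\{0,1\}^{|S|}$. A preference matrix on $Q_n$ is a $2^n\times n$ 0-1 matrix whose rows are the $2^n$ outcomes, each exactly once, ordered from most to least preferred. For a nonempty proper $S\subset Q_n$ and outcome $x$ on $Q_n-S$, $P^{[Q_n-S,x]}$ is the submatrix formed by the columns in $S$ and rows with outcome $x$ on $Q_n-S$ (in order); $S$ is separable with respect to $P$ if all these submatrices coincide for all $x$. $\mathcal{C}(G_n)$ is the set of preference matrices generated by Hamiltonian paths in the $n$-dimensional hypercube graph $G_n$ with Gray code labeling, i.e. preference matrices in which consecutive rows differ in exactly one entry. For $A\in\mathcal{C}(G_{n-1})$ and $k\in\{1,\dots,n\}$, $\mathrm{weave}_k^1(A)$ is the $2^{n}\times n$ matrix obtained by duplicating each row of $A$ (rows $2i-1$ and $2i$ both equal row $i$ of $A$) and inserting a new column in position $k$ (shifting later columns right) whose $i$-th entry is $1$ if $i\equiv 0,1 \pmod 4$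 and $0$ if $i\equiv 2,3\pmod 4$; $\mathrm{weave}_k^0(A)$ is the same with the new column bitwise complemented. In (2), $\vec w$ has $i$-th entry $1$ if $i\equiv 0,1\pmod 4$ and $0$ if $i\equiv 2,3 \pmod 4$. *)

theory Defs
  imports
    "HOL-Library.Z2"
    "Jordan_Normal_Form.DL_Submatrix"
    "Graph_Theory.Graph_Theory"
begin

text \<open>
  Entries are of the two-element type \<^typ>\<open>bit\<close>, so every matrix over it is a 0-1 matrix and
  \<open>carrier_vec n\<close> is the set \<open>{0,1}\<^sup>n\<close> of outcomes. Questions, rows and the
  position \<open>k\<close> are counted from 1, whereas the indices of vectors and matrices start at 0:
  question \<open>q\<close> sits in column \<open>q - 1\<close>, and the entry with index \<open>r\<close> is the
  \<open>Suc r\<close>-th one.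
\<close>

definition questions :: "nat \<Rightarrow> nat set" where
  "questions n = {1..n}"

abbreviation outcomes :: "nat \<Rightarrow> bit vec set" where
  "outcomes n \<equiv> carrier_vec n"

definition question_cols :: "nat set \<Rightarrow> nat set" where
  "question_cols S = {j. Suc j \<in> S}"

definition preference_matrix :: "nat \<Rightarrow> bit mat \<Rightarrow> bool" where
  "preference_matrix n P \<longleftrightarrow>
     P \<in> carrier_mat (2 ^ n) n \<and> bij_betw (row P) {..<2 ^ n} (outcomes n)"

text \<open>The entries of \<open>v\<close> at the questions in \<open>T\<close>, in increasing order.\<close>

definition restrict_outcome :: "bit vec \<Rightarrow> nat set \<Rightarrow> bit vec" where
  "restrict_outcome v T = vec (card T) (\<lambda>t. v $ pick (question_cols T) t)"

text \<open>This is \<open>P\<close> with superscript \<open>[Q\<^sub>n - S, x]\<close>.\<close>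

definition outcome_submatrix :: "nat \<Rightarrow> bit mat \<Rightarrow> nat set \<Rightarrow> bit vec \<Rightarrow> bit mat" where
  "outcome_submatrix n P S x =
     submatrix P
       {r. r < dim_row P \<and> restrict_outcome (row P r) (questions n - S) = x}
       (question_cols S)"

text \<open>
  The notion is meant for nonempty proper subsets \<open>S\<close> of the questions. For
  \<open>S = {}\<close> and for the set of all questions the definition is trivially satisfied by a
  preference matrix (all the submatrices then have no columns, or there is only one of them).
\<close>

definition separable :: "nat \<Rightarrow> bit mat \<Rightarrow> nat set \<Rightarrow> bool" where
  "separable n P S \<longleftrightarrow>
     (\<forall>x \<in> outcomes (card (questions n - S)). \<forall>y \<in> outcomes (card (questions n - S)).
        outcome_submatrix n P S x = outcome_submatrix n P S y)"

text \<open>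
  The hypercube as a symmetric digraph. Its vertices are their own labels, so that the labels of
  adjacent vertices differ in exactly one bit.
\<close>

definition hypercube :: "nat \<Rightarrow> bit vec pair_pre_digraph" where
  "hypercube n =
     \<lparr> pverts = outcomes n,
       parcs = {(u, v). u \<in> outcomes n \<and> v \<in> outcomes n \<and> (\<exists>!j. j < n \<and> u $ j \<noteq> v $ j)} \<rparr>"

definition hamiltonian_path :: "'a list \<Rightarrow> ('a, 'b) pre_digraph \<Rightarrow> bool" where
  "hamiltonian_path p G \<longleftrightarrow> vpath p G \<and> set p = verts G"

definition hypercube_matrices :: "nat \<Rightarrow> bit mat set" where
  "hypercube_matrices n =
     {mat_of_rows n p | p. hamiltonian_path p (with_proj (hypercube n))}"

definition weave_vec :: "nat \<Rightarrow> bit vec" where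
  "weave_vec N = vec N (\<lambda>r. if Suc r mod 4 \<in> {0, 1} then 1 else 0)"

definition complement_vec :: "bit vec \<Rightarrow> bit vec" where
  "complement_vec v = map_vec (\<lambda>b. 1 - b) v"

definition double_and_insert :: "nat \<Rightarrow> bit vec \<Rightarrow> bit mat \<Rightarrow> bit mat" where
  "double_and_insert k c A =
     mat (2 * dim_row A) (Suc (dim_col A))
       (\<lambda>(r, j). if Suc j < k then A $$ (r div 2, j)
                 else if Suc j = k then c $ r
                 else A $$ (r div 2, j - 1))"

definition weave1 :: "nat \<Rightarrow> bit mat \<Rightarrow> bit mat" where
  "weave1 k A = double_and_insert k (weave_vec (2 * dim_row A)) A"

definition weave0 :: "nat \<Rightarrow> bit mat \<Rightarrow> bit mat" where
  "weave0 k A = double_and_insert k (complement_vec (weave_vec (2 * dim_row A))) A"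

lemma card_outcomes: "card (outcomes n) = 2 ^ n"
proof -
  let ?L = "{xs. set xs \<subseteq> {0, 1 :: bit} \<and> length xs = n}"
  have bits: "set xs \<subseteq> {0, 1}" for xs :: "bit list"
  proof
    show "b \<in> {0, 1}" for b :: bit by (cases b) simp_all
  qed
  have "bij_betw list_of_vec (outcomes n) ?L"
  proof (rule bij_betw_byWitness[where f' = vec_of_list])
    show "\<forall>v \<in> outcomes n. vec_of_list (list_of_vec v) = v"
      by (simp add: vec_list)
    show "\<forall>xs \<in> ?L. list_of_vec (vec_of_list xs) = xs"
      by (simp add: list_vec)
    show "list_of_vec ` outcomes n \<subseteq> ?L"
    proof (rule image_subsetI, rule CollectI, rule conjI)
      show "set (list_of_vec v) \<subseteq> {0, 1}" for v :: "bit vec"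
        by (rule bits)
      show "length (list_of_vec v) = n" if "v \<in> outcomes n" for v :: "bit vec"
        using that by simp
    qed
    show "vec_of_list ` ?L \<subseteq> outcomes n"
    proof (rule image_subsetI)
      fix xs assume "xs \<in> ?L"
      then have "length xs = n" by blast
      then show "vec_of_list xs \<in> outcomes n" by (intro carrier_vecI) simp
    qed
  qed
  then have "card (outcomes n) = card ?L"
    by (rule bij_betw_same_card)
  also have "\<dots> = 2 ^ n"
    by (subst card_lists_length_eq) (simp_all add: card_insert_if numeral_2_eq_2)
  finally show ?thesis .
qed

lemma vwalk_arcs_nth:
  "length (vwalk_arcs p) = length p - 1"
  "Suc i < length p \<Longrightarrow> vwalk_arcs p ! i = (p ! i, p ! Suc i)"
proof -
  show "length (vwalk_arcs p) = length p - 1"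
    using vwalk_length_simp[of p] by (simp only: vwalk_length_def)
  show "Suc i < length p \<Longrightarrow> vwalk_arcs p ! i = (p ! i, p ! Suc i)"
  proof (induction p arbitrary: i rule: vwalk_arcs.induct)
    case (3 x y xs)
    then show ?case by (cases i) simp_all
  qed simp_all
qed

lemma set_vwalk_arcs: "set (vwalk_arcs p) = {(p ! i, p ! Suc i) | i. Suc i < length p}"
proof -
  have "i < length p - 1 \<longleftrightarrow> Suc i < length p" for i by linarith
  then show ?thesis
    unfolding set_conv_nth vwalk_arcs_nth(1) using vwalk_arcs_nth(2)[of _ p] by metis
qed

theorem hypercube_matrices_iff:
  "P \<in> hypercube_matrices n \<longleftrightarrow>
     preference_matrix n P \<and>
     (\<forall>i. Suc i < 2 ^ n \<longrightarrow> (\<exists>!j. j < n \<and> P $$ (i, j) \<noteq> P $$ (Suc i, j)))"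
    (is "_ \<longleftrightarrow> ?R")
proof
  assume "P \<in> hypercube_matrices n"
  then obtain p where P: "P = mat_of_rows n p" and p: "distinct p" "set p = outcomes n"
    and arcs: "set (vwalk_arcs p) \<subseteq> parcs (hypercube n)"
    by (auto simp: hypercube_matrices_def hamiltonian_path_def vpath_def vwalk_def
        hypercube_def arcs_ends_def arc_to_ends_def)
  have len: "length p = 2 ^ n"
    using p card_outcomes distinct_card by metis
  have dim: "p ! i \<in> outcomes n" if "i < 2 ^ n" for i
    using p len that nth_mem by metis
  have row: "row P i = p ! i" if "i < 2 ^ n" for i
    using that dim len P by simp
  have "bij_betw (row P) {..<2 ^ n} (outcomes n)"
    using bij_betw_nth[OF p(1), of "{..<2 ^ n}" "outcomes n"] len p(2) row
    by (subst bij_betw_cong[of _ _ "(!) p"]) auto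
  then have "preference_matrix n P"
    using P mat_of_rows_carrier(1)[of n p] by (simp add: preference_matrix_def len)
  moreover have "\<exists>!j. j < n \<and> P $$ (i, j) \<noteq> P $$ (Suc i, j)" if i: "Suc i < 2 ^ n" for i
  proof -
    have "(p ! i, p ! Suc i) \<in> parcs (hypercube n)"
      using arcs i len by (auto simp: set_vwalk_arcs)
    then have "\<exists>!j. j < n \<and> p ! i $ j \<noteq> p ! Suc i $ j"
      by (simp add: hypercube_def)
    moreover have "(j < n \<and> P $$ (i, j) \<noteq> P $$ (Suc i, j)) =
        (j < n \<and> p ! i $ j \<noteq> p ! Suc i $ j)" for j
      using i len by (auto simp: P mat_of_rows_def)
    ultimately show ?thesis by simp
  qed
  ultimately show ?R by blast
next
  assume R: ?R
  then have P: "P \<in> carrier_mat (2 ^ n) n" and bij: "bij_betw (row P) {..<2 ^ n} (outcomes n)"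
    by (auto simp: preference_matrix_def)
  define p where "p = rows P"
  have len: "length p = 2 ^ n" using P by (simp add: p_def)
  have nth: "p ! i = row P i" if "i < 2 ^ n" for i using P that by (simp add: p_def)
  have set: "set p = outcomes n"
    using bij P by (auto simp: p_def rows_def bij_betw_def atLeast0LessThan)
  have dist: "distinct p"
    using set len card_outcomes[of n] card_distinct by metis
  have "(p ! i, p ! Suc i) \<in> parcs (hypercube n)" if i: "Suc i < length p" for i
  proof -
    have "\<exists>!j. j < n \<and> P $$ (i, j) \<noteq> P $$ (Suc i, j)" using R i len by simp
    moreover have "(j < n \<and> P $$ (i, j) \<noteq> P $$ (Suc i, j)) =
        (j < n \<and> p ! i $ j \<noteq> p ! Suc i $ j)" for j
      using i len P by (auto simp: nth)
    ultimately have "\<exists>!j. j < n \<and> p ! i $ j \<noteq> p ! Suc i $ j" by simp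
    moreover have "p ! i \<in> outcomes n" "p ! Suc i \<in> outcomes n"
      using set i nth_mem Suc_lessD by metis+
    ultimately show ?thesis by (simp add: hypercube_def)
  qed
  then have "set (vwalk_arcs p) \<subseteq> parcs (hypercube n)"
    by (auto simp: set_vwalk_arcs)
  moreover have "p \<noteq> []" using len by auto
  ultimately have "hamiltonian_path p (with_proj (hypercube n))"
    using set dist
    by (auto simp: hamiltonian_path_def vpath_def vwalk_def hypercube_def
        arcs_ends_def arc_to_ends_def)
  moreover have "P = mat_of_rows n p"
    using P by (auto simp: p_def)
  ultimately show "P \<in> hypercube_matrices n"
    by (auto simp: hypercube_matrices_def)
qed

end

theory Submission
  imports Defs "Jordan_Normal_Form.Determinant"
begin

text \<open>
  Write \<open>c r\<close> for the entry of row \<open>r\<close> in column \<open>k\<close> and say that two rows agree if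
  they coincide outside this column. Every row agrees with exactly one other row, and two
  consecutive rows agree if and only if \<open>c\<close> changes between them. Each of the three conditions
  is equivalent to \<open>c (2 * i) \<noteq> c (2 * i + 1)\<close> for all \<open>i\<close>, that is, to the partners being
  the rows \<open>2 * i\<close> and \<open>2 * i + 1\<close>.

  For separability, let \<open>i\<close> be minimal with \<open>c (2 * i) = c (2 * i + 1)\<close>. The rows before
  \<open>2 * i\<close> contain \<open>i\<close> rows of each value of \<open>c\<close>, so separability makes row \<open>2 * i\<close> agree
  with the first later row \<open>s\<close> of the other value. But \<open>s\<close> also agrees with \<open>s - 1\<close>, where
  \<open>c\<close> has just changed; as \<open>s - 1 > 2 * i\<close>, row \<open>s\<close> has two partners, a contradiction.
\<close>

section \<open>Bits, submatrices and ranks\<close>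

lemma bit_eq_if_neq: "(a :: bit) \<noteq> b \<Longrightarrow> c \<noteq> b \<Longrightarrow> a = c"
  by (cases a; cases b; cases c) simp_all

text \<open>Modulo 2 the hypothesis says \<open>a + b + c + d = 0\<close>, which is symmetric in the
  four bits.\<close>

lemma bit_eq_exchange:
  fixes a b c d :: bit
  assumes "a = b \<longleftrightarrow> c = d"
  shows "a = c \<longleftrightarrow> b = d"
  using assms by (cases a; cases b; cases c; cases d) simp_all

text \<open>Only the row sets differ, so rows are compared through \<open>pick\<close>, while a
  common column can be named by its index in \<open>A\<close>.\<close>

lemma submatrix_eq_iff:
  assumes "dim_row A = nr" and "dim_col A = nc"
  shows "submatrix A I J = submatrix A I' J \<longleftrightarrow>
    card {i. i < nr \<and> i \<in> I} = card {i. i < nr \<and> i \<in> I'} \<and>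
    (\<forall>i < card {i. i < nr \<and> i \<in> I}. \<forall>j < nc. j \<in> J \<longrightarrow> A $$ (pick I i, j) = A $$ (pick I' i, j))"
    (is "?L \<longleftrightarrow> ?R")
proof
  assume L: ?L
  have dims: "card {i. i < nr \<and> i \<in> I} = card {i. i < nr \<and> i \<in> I'}"
    using arg_cong[OF L, of dim_row] assms by (simp add: dim_submatrix)
  moreover have "A $$ (pick I i, j) = A $$ (pick I' i, j)"
    if i: "i < card {i. i < nr \<and> i \<in> I}" and j: "j < nc" "j \<in> J" for i j
  proof -
    \<comment> \<open>The position that column \<open>j\<close> of \<open>A\<close> takes in both
      submatrices.\<close>
    let ?t = "card {a \<in> J. a < j}"
    have t: "pick J ?t = j" using j(2) by (rule pick_card_in_set)
    have "{a \<in> J. a < j} \<subset> {j. j < dim_col A \<and> j \<in> J}"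
      using j assms by auto
    then have lt: "?t < card {j. j < dim_col A \<and> j \<in> J}"
      by (simp add: psubset_card_mono)
    show ?thesis
      using submatrix_index[of i A I ?t J] submatrix_index[of i A I' ?t J] i lt dims assms L t
      by simp
  qed
  ultimately show ?R by blast
next
  assume R: ?R
  have J: "pick J t < dim_col A \<and> pick J t \<in> J" if "t < card {j. j < dim_col A \<and> j \<in> J}" for t
    using pick_le[OF that] pick_in_set_le[OF that] pick_reduce_set[OF that] by simp
  show ?L
    using R J assms by (intro eq_matI) (auto simp: dim_submatrix submatrix_index)
qed

text \<open>Each pair of rows \<open>2 * j\<close>, \<open>2 * j + 1\<close> contributes exactly one
  row of value \<open>x\<close>.\<close>

lemma card_alternating:
  fixes c :: "nat \<Rightarrow> bit"
  assumes "\<And>j. j < i \<Longrightarrow> c (2 * j) \<noteq> c (2 * j + 1)"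
  shows "card {r. r < 2 * i \<and> c r = x} = i"
  using assms
proof (induction i)
  case (Suc i)
  have neq: "c (2 * i) \<noteq> c (2 * i + 1)" using Suc.prems by blast
  have less: "r < 2 * Suc i \<longleftrightarrow> r = 2 * i \<or> r = 2 * i + 1 \<or> r < 2 * i" for r by auto
  have "{r. r < 2 * Suc i \<and> c r = x} =
      insert (if c (2 * i) = x then 2 * i else 2 * i + 1) {r. r < 2 * i \<and> c r = x}"
    using neq bit_eq_if_neq[of x "c (2 * i)" "c (2 * i + 1)"] unfolding less by auto
  moreover have "card {r. r < 2 * i \<and> c r = x} = i" using Suc by simp
  ultimately show ?case by simp
qed simp

text \<open>The number of elements of \<open>A\<close> below a member \<open>s\<close> is the
  position at which \<open>pick\<close> returns \<open>s\<close>, so comparing such ranks locates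
  picked rows.\<close>

lemma rank_strict_mono:
  fixes s t :: nat
  assumes "s \<in> A" "s < t"
  shows "card {a \<in> A. a < s} < card {a \<in> A. a < t}"
proof (rule psubset_card_mono)
  show "{a \<in> A. a < s} \<subset> {a \<in> A. a < t}" using assms by auto
qed simp

section \<open>The weave vector and its complement\<close>

lemma weave_vec_step:
  assumes "Suc r < N"
  shows "weave_vec N $ r = weave_vec N $ Suc r \<longleftrightarrow> odd r"
proof -
  have "odd r \<longleftrightarrow> odd (r mod 4)" by presburger
  moreover have "r mod 4 = 0 \<or> r mod 4 = 1 \<or> r mod 4 = 2 \<or> r mod 4 = 3" by linarith
  ultimately have "(Suc r mod 4 \<in> {0, 1} \<longleftrightarrow> Suc (Suc r) mod 4 \<in> {0, 1}) \<longleftrightarrow> odd r"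
    by (auto simp: mod_Suc)
  moreover have "weave_vec N $ r = of_bool (Suc r mod 4 \<in> {0, 1})" if "r < N" for r
    using that by (simp add: weave_vec_def)
  ultimately show ?thesis using assms by (simp only: Suc_lessD of_bool_eq_iff)
qed

text \<open>A bit vector is determined up to complement by the places where it changes; for the
  weave vector these are the steps that start at an even index.\<close>

lemma weave_or_complement_iff:
  assumes v: "v \<in> carrier_vec N"
  shows "v = weave_vec N \<or> v = complement_vec (weave_vec N) \<longleftrightarrow>
    (\<forall>r. Suc r < N \<longrightarrow> (v $ r = v $ Suc r \<longleftrightarrow> odd r))" (is "?L \<longleftrightarrow> ?R")
proof -
  have w: "dim_vec (weave_vec N) = N" by (simp add: weave_vec_def)
  show ?thesis
  proof
    assume L: ?L
    show ?R
    proof (intro allI impI)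
      fix r assume r: "Suc r < N"
      have "1 - a = 1 - b \<longleftrightarrow> a = b" for a b :: bit
        by (cases a; cases b) simp_all
      then have "v $ r = v $ Suc r \<longleftrightarrow> weave_vec N $ r = weave_vec N $ Suc r"
        using L r w unfolding complement_vec_def by fastforce
      then show "v $ r = v $ Suc r \<longleftrightarrow> odd r" using weave_vec_step[OF r] by simp
    qed
  next
    assume R: ?R
    \<comment> \<open>Both vectors change at the same places, so whether they coincide at
      \<open>r\<close> does not depend on \<open>r\<close>.\<close>
    have sync: "v $ r = weave_vec N $ r \<longleftrightarrow> v $ 0 = weave_vec N $ 0" if "r < N" for r
      using that
    proof (induction r)
      case (Suc r)
      have "v $ r = weave_vec N $ r \<longleftrightarrow> v $ Suc r = weave_vec N $ Suc r"
        by (rule bit_eq_exchange) (use R weave_vec_step[of r N] Suc.prems in blast)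
      then show ?case using Suc by (metis Suc_lessD)
    qed simp
    have compl: "a \<noteq> b \<Longrightarrow> a = 1 - b" for a b :: bit
      by (cases a; cases b) simp_all
    show ?L
    proof (cases "v $ 0 = weave_vec N $ 0")
      case True
      then have "v $ r = weave_vec N $ r" if "r < N" for r using sync that by blast
      then have "v = weave_vec N" by (intro eq_vecI) (use v w in auto)
      then show ?thesis ..
    next
      case False
      then have "v $ r = 1 - weave_vec N $ r" if "r < N" for r using sync that compl by blast
      then have "v = complement_vec (weave_vec N)"
        unfolding complement_vec_def by (intro eq_vecI) (use v w in auto)
      then show ?thesis ..
    qed
  qed
qed

section \<open>One column of a hypercube matrix and the pairs of agreeing rows\<close>

locale hypercube_column =
  fixes n l :: nat and P :: "bit mat"
  assumes P: "P \<in> hypercube_matrices n" and l: "l < n"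
begin

abbreviation c :: "nat \<Rightarrow> bit" where
  "c r \<equiv> P $$ (r, l)"

definition agree :: "nat \<Rightarrow> nat \<Rightarrow> bool" where
  "agree r s \<longleftrightarrow> (\<forall>j < n. j \<noteq> l \<longrightarrow> P $$ (r, j) = P $$ (s, j))"

definition alternating :: bool where
  "alternating \<longleftrightarrow> (\<forall>i < 2 ^ (n - 1). c (2 * i) \<noteq> c (2 * i + 1))"

lemma pow: "2 ^ n = 2 * (2 :: nat) ^ (n - 1)"
  using l by (cases n) simp_all

lemma dims: "dim_row P = 2 ^ n" "dim_col P = n"
  using P by (auto simp: hypercube_matrices_iff preference_matrix_def)

lemma agree_trans: "agree r s \<Longrightarrow> agree s t \<Longrightarrow> agree r t"
  and agree_sym: "agree r s \<Longrightarrow> agree s r"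
  by (auto simp: agree_def)

text \<open>This yields uniqueness of partners: two rows that agree with a third and differ from it
  in column \<open>l\<close> have the same bit there.\<close>

lemma row_eqI:
  assumes "agree r s" "c r = c s" "r < 2 ^ n" "s < 2 ^ n"
  shows "r = s"
proof -
  have "row P r = row P s"
    using assms dims by (intro eq_vecI) (auto simp: agree_def)
  moreover have "inj_on (row P) {..<2 ^ n}"
    using P by (auto simp: hypercube_matrices_iff preference_matrix_def bij_betw_def)
  ultimately show ?thesis using assms by (auto dest: inj_onD)
qed

lemma step: "Suc r < 2 ^ n \<Longrightarrow> \<exists>!j. j < n \<and> P $$ (r, j) \<noteq> P $$ (Suc r, j)"
  using P by (auto simp: hypercube_matrices_iff)

lemma agree_step: "Suc r < 2 ^ n \<Longrightarrow> c r \<noteq> c (Suc r) \<Longrightarrow> agree r (Suc r)"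
  using step[of r] l by (auto simp: agree_def)

lemma alternatingD:
  assumes alternating "i < 2 ^ (n - 1)"
  shows "c (2 * i) \<noteq> c (Suc (2 * i))" "agree (2 * i) (Suc (2 * i))"
proof -
  show neq: "c (2 * i) \<noteq> c (Suc (2 * i))" using assms by (simp add: alternating_def)
  show "agree (2 * i) (Suc (2 * i))" using assms by (intro agree_step neq) (simp add: pow)
qed

text \<open>A change here would make rows \<open>2 * i\<close> and \<open>2 * i + 2\<close> both
  differ from row \<open>2 * i + 1\<close> exactly in column \<open>l\<close>, hence be the same
  row.\<close>

lemma alternating_stay:
  assumes alternating "Suc i < 2 ^ (n - 1)"
  shows "c (Suc (2 * i)) = c (2 * Suc i)"
proof (rule ccontr)
  assume neq: "c (Suc (2 * i)) \<noteq> c (2 * Suc i)"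
  have "agree (Suc (2 * i)) (2 * Suc i)"
    using agree_step[of "Suc (2 * i)"] neq assms by (simp add: pow)
  then have "agree (2 * i) (2 * Suc i)"
    using agree_trans alternatingD[OF assms(1)] assms(2) Suc_lessD by blast
  moreover have "c (2 * i) = c (2 * Suc i)"
    using neq alternatingD(1)[OF assms(1), of i] assms(2)
    by (intro bit_eq_if_neq[of _ "c (Suc (2 * i))"]) auto
  ultimately have "2 * i = 2 * Suc i" using assms by (intro row_eqI) (simp_all add: pow)
  then show False by simp
qed

lemma weave_column_iff:
  "col P l = weave_vec (2 ^ n) \<or> col P l = complement_vec (weave_vec (2 ^ n)) \<longleftrightarrow> alternating"
proof -
  have "(\<forall>r. Suc r < 2 ^ n \<longrightarrow> (c r = c (Suc r) \<longleftrightarrow> odd r)) \<longleftrightarrow> alternating" (is "?L \<longleftrightarrow> _")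
  proof
    assume ?L
    then show alternating by (auto simp: alternating_def pow)
  next
    assume alt: alternating
    show ?L
    proof (intro allI impI)
      fix r assume r: "Suc r < 2 ^ n"
      show "c r = c (Suc r) \<longleftrightarrow> odd r"
      proof (cases "even r")
        case True
        then obtain i where "r = 2 * i" ..
        then show ?thesis using alternatingD(1)[OF alt, of i] r by (simp add: pow)
      next
        case False
        then obtain i where "r = 2 * i + 1" ..
        then show ?thesis using alternating_stay[OF alt, of i] r by (simp add: pow)
      qed
    qed
  qed
  moreover have "col P l \<in> carrier_vec (2 ^ n)" using dims by (simp add: carrier_vecI)
  ultimately show ?thesis
    using dims l by (subst weave_or_complement_iff) simp_all
qed

section \<open>Separability\<close>

definition rows_with :: "bit \<Rightarrow> nat set" where
  "rows_with x = {r. r < 2 ^ n \<and> c r = x}"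

lemma finite_rows_with: "finite (rows_with x)"
  by (simp add: rows_with_def)

text \<open>Only question \<open>Suc l\<close> lies outside the set, so an outcome there is a single
  bit, and the columns kept are those that \<open>agree\<close> compares.\<close>

lemma separable_iff_agree:
  "separable n P (questions n - {Suc l}) \<longleftrightarrow>
    (\<forall>x y. card (rows_with x) = card (rows_with y) \<and>
      (\<forall>i < card (rows_with x). agree (pick (rows_with x) i) (pick (rows_with y) i)))"
proof -
  let ?S = "questions n - {Suc l}"
  have T: "questions n - ?S = {Suc l}" using l by (auto simp: questions_def)
  have "question_cols {Suc l} = {l}" by (auto simp: question_cols_def)
  moreover have "pick {l} 0 = l" using pick_in_set_le[of 0 "{l}"] by simp
  ultimately have restrict: "restrict_outcome v {Suc l} = vec 1 (\<lambda>_. v $ l)" for v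
    unfolding restrict_outcome_def by (intro eq_vecI) (simp_all del: pick.simps)
  have "vec 1 (\<lambda>_. b) = x \<longleftrightarrow> b = x $ 0" if "x \<in> outcomes 1" for b :: bit and x
    using that by auto
  then have out: "outcome_submatrix n P ?S x = submatrix P (rows_with (x $ 0)) (question_cols ?S)"
    if "x \<in> outcomes 1" for x
    unfolding outcome_submatrix_def T restrict rows_with_def
    using that dims l by (intro arg_cong2[where f = "\<lambda>I J. submatrix P I J"] refl) auto
  have rows: "{r. r < 2 ^ n \<and> r \<in> rows_with x} = rows_with x" for x
    by (auto simp: rows_with_def)
  have cols: "j \<in> question_cols ?S \<longleftrightarrow> j \<noteq> l" if "j < n" for j
    using that by (auto simp: question_cols_def questions_def)
  have "separable n P ?S \<longleftrightarrow> (\<forall>x y. submatrix P (rows_with x) (question_cols ?S) =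
      submatrix P (rows_with y) (question_cols ?S))" (is "_ \<longleftrightarrow> (\<forall>x y. ?M x = ?M y)")
  proof
    assume sep: "separable n P ?S"
    show "\<forall>x y. ?M x = ?M y"
    proof (intro allI)
      fix x y
      have "outcome_submatrix n P ?S (vec 1 (\<lambda>_. x)) = outcome_submatrix n P ?S (vec 1 (\<lambda>_. y))"
        using sep unfolding separable_def T by simp
      then show "?M x = ?M y" by (simp add: out)
    qed
  next
    assume "\<forall>x y. ?M x = ?M y"
    then show "separable n P ?S" unfolding separable_def T by (auto simp: out)
  qed
  then show ?thesis
    by (simp add: submatrix_eq_iff[OF dims] rows cols agree_def)
qed

lemma card_rows_below:
  assumes "i \<le> 2 ^ (n - 1)" and "\<And>j. j < i \<Longrightarrow> c (2 * j) \<noteq> c (2 * j + 1)"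
  shows "card {a \<in> rows_with x. a < 2 * i} = i"
proof -
  have "{a \<in> rows_with x. a < 2 * i} = {r. r < 2 * i \<and> c r = x}"
    using assms(1) by (auto simp: rows_with_def pow)
  then show ?thesis using card_alternating[of i c] assms(2) by simp
qed

lemma separable_imp_alternating:
  assumes "separable n P (questions n - {Suc l})"
  shows alternating
  unfolding alternating_def
proof (intro allI impI)
  fix i :: nat
  show "i < 2 ^ (n - 1) \<Longrightarrow> c (2 * i) \<noteq> c (2 * i + 1)"
  proof (induction i rule: less_induct)
    case (less i)
    show ?case
    proof
      assume eq: "c (2 * i) = c (2 * i + 1)"
      let ?x = "c (2 * i)"
      obtain y where y: "y \<noteq> ?x" by (metis bit.distinct(1))
      have below: "card {a \<in> rows_with z. a < 2 * i} = i" for z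
        using less by (intro card_rows_below) auto
      have mem: "2 * i \<in> rows_with ?x" using less.prems by (simp add: rows_with_def pow)
      have pick_x: "pick (rows_with ?x) i = 2 * i"
        using pick_card_in_set[OF mem] below by simp
      have "{a \<in> rows_with ?x. a < 2 * i} \<subset> rows_with ?x" using mem by auto
      then have card_x: "i < card (rows_with ?x)"
        using psubset_card_mono[OF finite_rows_with] below by metis
      define s where "s = pick (rows_with y) i"
      have card_y: "i < card (rows_with y)" and agree_s: "agree (2 * i) s"
        using assms card_x pick_x unfolding separable_iff_agree s_def by metis+
      have s: "s \<in> rows_with y" and rank_s: "card {a \<in> rows_with y. a < s} = i"
        using pick_in_set_le[OF card_y] card_pick_le[OF card_y] by (simp_all add: s_def)
      \<comment> \<open>Exactly \<open>i\<close> rows of value \<open>y\<close> lie before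
        \<open>2 * i\<close>, so each of them has rank less than \<open>i\<close>.\<close>
      have "\<not> s < 2 * i"
        using rank_strict_mono[OF s] rank_s below by fastforce
      \<comment> \<open>The assumed equality rules out \<open>2 * i + 1\<close> too; hence the
        predecessor \<open>t\<close> of \<open>s\<close> is still beyond
        \<open>2 * i\<close>.\<close>
      moreover have "s \<noteq> 2 * i" "s \<noteq> 2 * i + 1" using s y eq by (auto simp: rows_with_def)
      ultimately obtain t where t: "s = Suc t" "2 * i < t" by (cases s) auto
      \<comment> \<open>Rank \<open>i\<close> is already reached at \<open>2 * i\<close>, so no row
        of value \<open>y\<close> lies between there and \<open>s\<close>.\<close>
      have "c t \<noteq> y"
      proof
        assume "c t = y"
        then have "t \<in> rows_with y" using s t by (simp add: rows_with_def)
        then have "card {a \<in> rows_with y. a < t} < i" using rank_strict_mono t rank_s by blast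
        moreover have "i \<le> card {a \<in> rows_with y. a < t}"
          using t below[of y] card_mono[of "{a \<in> rows_with y. a < t}" "{a \<in> rows_with y. a < 2 * i}"]
          by fastforce
        ultimately show False by simp
      qed
      then have c_t: "c t = ?x" using y bit_eq_if_neq[of "c t" y ?x] by simp
      have s_less: "Suc t < 2 ^ n" "c (Suc t) = y" using s t by (auto simp: rows_with_def)
      then have "agree t s" using agree_step[of t] t \<open>c t \<noteq> y\<close> by simp
      then have "agree (2 * i) t" using agree_s agree_trans agree_sym by blast
      then have "2 * i = t" using c_t t s_less by (intro row_eqI) auto
      then show False using t by simp
    qed
  qed
qed

text \<open>Every pair \<open>2 * i\<close>, \<open>2 * i + 1\<close> has one row of each value, so
  the row at position \<open>i\<close> among those of value \<open>x\<close> lies in pair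
  \<open>i\<close> and agrees with row \<open>2 * i\<close>, whatever \<open>x\<close> is.\<close>

lemma alternating_imp_separable:
  assumes alt: alternating
  shows "separable n P (questions n - {Suc l})"
proof -
  have below: "card {a \<in> rows_with x. a < 2 * i} = i" if "i \<le> 2 ^ (n - 1)" for i x
    using alt that by (intro card_rows_below) (auto simp: alternating_def)
  have card: "card (rows_with x) = 2 ^ (n - 1)" for x
  proof -
    have "{a \<in> rows_with x. a < 2 * 2 ^ (n - 1)} = rows_with x"
      by (auto simp: rows_with_def pow)
    then show ?thesis using below[of "2 ^ (n - 1)" x] by simp
  qed
  have pick: "agree (2 * i) (pick (rows_with x) i)" if i: "i < 2 ^ (n - 1)" for i x
  proof (cases "c (2 * i) = x")
    case True
    then have "2 * i \<in> rows_with x" using i by (simp add: rows_with_def pow)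
    then have "pick (rows_with x) i = 2 * i"
      using pick_card_in_set[of "2 * i" "rows_with x"] below[of i x] i by simp
    then show ?thesis by (simp add: agree_def)
  next
    case False
    then have "c (Suc (2 * i)) = x" using alternatingD(1)[OF alt i] by (intro bit_eq_if_neq[of _ "c (2 * i)"]) auto
    then have "Suc (2 * i) \<in> rows_with x" using i by (simp add: rows_with_def pow)
    \<comment> \<open>Row \<open>2 * i\<close> has the other value and so does not raise the rank of
      its partner.\<close>
    moreover have "{a \<in> rows_with x. a < Suc (2 * i)} = {a \<in> rows_with x. a < 2 * i}"
      using False by (auto simp: rows_with_def less_Suc_eq)
    ultimately have "pick (rows_with x) i = Suc (2 * i)"
      using pick_card_in_set[of "Suc (2 * i)" "rows_with x"] below[of i x] i by simp
    then show ?thesis using alternatingD(2)[OF alt i] by simp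
  qed
  show ?thesis
    unfolding separable_iff_agree card using pick agree_trans agree_sym by blast
qed

lemma separable_iff_alternating:
  "separable n P (questions n - {Suc l}) \<longleftrightarrow> alternating"
  using separable_imp_alternating alternating_imp_separable by blast

section \<open>Recovering the matrix that is woven\<close>

definition unweave :: "bit mat" where
  "unweave = mat (2 ^ (n - 1)) (n - 1) (\<lambda>(i, j). P $$ (2 * i, insert_index l j))"

lemma insert_index_less: "j < n - 1 \<Longrightarrow> insert_index l j < n"
  and insert_index_neq: "insert_index l j \<noteq> l"
  by (auto simp: insert_index_def)

lemma obtain_insert_index:
  assumes "j < n" "j \<noteq> l"
  obtains j' where "j' < n - 1" "j = insert_index l j'"
proof
  show "delete_index l j < n - 1" using assms l by (auto simp: delete_index_def)
  show "j = insert_index l (delete_index l j)" using assms by (simp add: insert_delete_index)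
qed

lemma unweave_mem:
  assumes alt: alternating
  shows "unweave \<in> hypercube_matrices (n - 1)"
proof -
  have carrier: "unweave \<in> carrier_mat (2 ^ (n - 1)) (n - 1)" by (simp add: unweave_def)
  have inj: "inj_on (row unweave) {..<2 ^ (n - 1)}"
  proof (rule inj_onI)
    fix i j assume i: "i \<in> {..<2 ^ (n - 1)}" and j: "j \<in> {..<2 ^ (n - 1)}"
      and eq: "row unweave i = row unweave j"
    have agree: "agree (2 * i) (2 * j)"
      unfolding agree_def
    proof (intro allI impI)
      fix q assume "q < n" "q \<noteq> l"
      then obtain q' where q': "q' < n - 1" "q = insert_index l q'" by (rule obtain_insert_index)
      have "row unweave i $ q' = row unweave j $ q'" using eq by simp
      then show "P $$ (2 * i, q) = P $$ (2 * j, q)" using q' i j by (simp add: unweave_def)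
    qed
    show "i = j"
    proof (cases "c (2 * i) = c (2 * j)")
      case True
      then have "2 * i = 2 * j" using agree i j by (intro row_eqI) (auto simp: pow)
      then show ?thesis by simp
    next
      \<comment> \<open>Here row \<open>2 * i\<close> would be row \<open>2 * j + 1\<close>, the
        partner of row \<open>2 * j\<close>, which parity excludes.\<close>
      case False
      then have "c (2 * i) = c (Suc (2 * j))"
        using alternatingD(1)[OF alt, of j] j by (intro bit_eq_if_neq[of _ "c (2 * j)"]) auto
      moreover have "agree (2 * i) (Suc (2 * j))"
        using agree alternatingD(2)[OF alt, of j] j agree_trans by blast
      ultimately have "2 * i = Suc (2 * j)" using i j by (intro row_eqI) (auto simp: pow)
      then show ?thesis by presburger
    qed
  qed
  \<comment> \<open>Distinct rows, as many as there are outcomes, exhaust the outcomes.\<close>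
  have "row unweave ` {..<2 ^ (n - 1)} = outcomes (n - 1)"
  proof (rule card_subset_eq)
    show "finite (outcomes (n - 1) :: bit vec set)"
      using card_outcomes[of "n - 1"] by (intro card_ge_0_finite) simp
    show "row unweave ` {..<2 ^ (n - 1)} \<subseteq> outcomes (n - 1)"
      using carrier by (auto intro!: carrier_vecI)
    show "card (row unweave ` {..<2 ^ (n - 1)}) = card (outcomes (n - 1) :: bit vec set)"
      using card_image[OF inj] by (simp add: card_outcomes)
  qed
  then have "preference_matrix (n - 1) unweave"
    using carrier inj by (simp add: preference_matrix_def bij_betw_def)
  moreover have "\<exists>!j. j < n - 1 \<and> unweave $$ (i, j) \<noteq> unweave $$ (Suc i, j)"
    if i: "Suc i < 2 ^ (n - 1)" for i
  proof -
    \<comment> \<open>Row \<open>i\<close> of \<open>unweave\<close> is also row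
      \<open>2 * i + 1\<close> of \<open>P\<close> without column \<open>l\<close>, so its step to
      row \<open>Suc i\<close> is the single step of \<open>P\<close> from \<open>?r\<close> to
      \<open>Suc ?r\<close>, in which column \<open>l\<close> stays fixed.\<close>
    let ?r = "Suc (2 * i)"
    have entries: "unweave $$ (i, j) \<noteq> unweave $$ (Suc i, j) \<longleftrightarrow>
        P $$ (?r, insert_index l j) \<noteq> P $$ (Suc ?r, insert_index l j)" if "j < n - 1" for j
      using that i alternatingD(2)[OF alt, of i] insert_index_less[OF that] insert_index_neq[of j]
      by (simp add: unweave_def agree_def)
    have ex1: "\<exists>!q. q < n \<and> P $$ (?r, q) \<noteq> P $$ (Suc ?r, q)"
      using i by (intro step) (simp add: pow)
    then obtain q where q: "q < n" "P $$ (?r, q) \<noteq> P $$ (Suc ?r, q)" by blast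
    then have "q \<noteq> l" using alternating_stay[OF alt i] by auto
    with q(1) obtain q' where q': "q' < n - 1" "q = insert_index l q'" by (rule obtain_insert_index)
    show ?thesis
    proof (rule ex1I)
      show "q' < n - 1 \<and> unweave $$ (i, q') \<noteq> unweave $$ (Suc i, q')"
        using q' q entries by simp
      fix j assume j: "j < n - 1 \<and> unweave $$ (i, j) \<noteq> unweave $$ (Suc i, j)"
      then have "insert_index l j = q"
        using ex1 q entries insert_index_less by blast
      then show "j = q'" using q' delete_insert_index by metis
    qed
  qed
  ultimately show ?thesis by (simp add: hypercube_matrices_iff)
qed

text \<open>Inserting \<open>col P l\<close> itself leaves the choice between \<open>weave1\<close>
  and \<open>weave0\<close> to \<open>weave_column_iff\<close>.\<close>

lemma double_and_insert_unweave:
  assumes alt: alternating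
  shows "P = double_and_insert (Suc l) (col P l) unweave"
proof (rule eq_matI)
  show "dim_row P = dim_row (double_and_insert (Suc l) (col P l) unweave)"
    "dim_col P = dim_col (double_and_insert (Suc l) (col P l) unweave)"
    using l by (simp_all add: double_and_insert_def unweave_def dims pow)
  fix r j
  assume "r < dim_row (double_and_insert (Suc l) (col P l) unweave)"
    "j < dim_col (double_and_insert (Suc l) (col P l) unweave)"
  then have r: "r < 2 * 2 ^ (n - 1)" and j: "j < n"
    using l by (simp_all add: double_and_insert_def unweave_def)
  have half: "r div 2 < 2 ^ (n - 1)" using r by simp
  have "r = 2 * (r div 2) \<or> r = Suc (2 * (r div 2))" by presburger
  then have "agree r (2 * (r div 2))"
  proof
    assume "r = Suc (2 * (r div 2))"
    then show ?thesis using agree_sym[OF alternatingD(2)[OF alt half]] by simp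
  qed (simp add: agree_def)
  then have "P $$ (r, j) = P $$ (2 * (r div 2), j)" if "j \<noteq> l"
    using that j by (simp add: agree_def)
  then show "P $$ (r, j) = double_and_insert (Suc l) (col P l) unweave $$ (r, j)"
    using r j half l dims
    by (auto simp: double_and_insert_def unweave_def insert_index_def pow)
qed

text \<open>From a woven form only the inserted column is read off, which
  \<open>weave_column_iff\<close> then settles; conversely, \<open>unweave\<close> is the
  witness.\<close>

lemma weave_iff_alternating:
  "(\<exists>A \<in> hypercube_matrices (n - 1). P = weave1 (Suc l) A \<or> P = weave0 (Suc l) A) \<longleftrightarrow> alternating"
    (is "?L \<longleftrightarrow> _")
proof
  assume ?L
  then obtain A where "A \<in> hypercube_matrices (n - 1)"
    and PA: "P = weave1 (Suc l) A \<or> P = weave0 (Suc l) A" by blast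
  then have "2 * dim_row A = 2 ^ n" "dim_col A = n - 1"
    by (auto simp: hypercube_matrices_iff preference_matrix_def pow)
  moreover have "col (double_and_insert (Suc l) v A) l = v"
    if "v \<in> carrier_vec (2 * dim_row A)" "l < Suc (dim_col A)" for v
    using that by (intro eq_vecI) (auto simp: double_and_insert_def)
  ultimately have "col P l = weave_vec (2 ^ n) \<or> col P l = complement_vec (weave_vec (2 ^ n))"
    using PA l unfolding weave1_def weave0_def
    by (auto simp: weave_vec_def complement_vec_def intro!: carrier_vecI)
  then show alternating by (simp add: weave_column_iff)
next
  assume alt: alternating
  have "2 * dim_row unweave = 2 ^ n" by (simp add: unweave_def pow)
  then have "P = weave1 (Suc l) unweave \<or> P = weave0 (Suc l) unweave"
    using alt weave_column_iff double_and_insert_unweave[OF alt]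
    unfolding weave1_def weave0_def by metis
  then show ?L using unweave_mem[OF alt] by blast
qed

end

theorem theorem7:
  fixes n k :: nat and P :: "bit mat"
  assumes "P \<in> hypercube_matrices n"
    and "k \<in> questions n"
  shows "(separable n P (questions n - {k}) \<longleftrightarrow>
            col P (k - 1) = weave_vec (2 ^ n) \<or>
            col P (k - 1) = complement_vec (weave_vec (2 ^ n)))
       \<and> ((col P (k - 1) = weave_vec (2 ^ n) \<or>
            col P (k - 1) = complement_vec (weave_vec (2 ^ n))) \<longleftrightarrow>
          (\<exists>P\<^sub>1 \<in> hypercube_matrices (n - 1). P = weave1 k P\<^sub>1 \<or> P = weave0 k P\<^sub>1))"
proof -
  \<comment> \<open>Questions are counted from 1, so question \<open>k\<close> sits in the column
    with index \<open>l\<close>.\<close>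
  obtain l where k: "k = Suc l" and l: "l < n"
    using assms(2) by (cases k) (auto simp: questions_def)
  interpret hypercube_column n l P
    using assms(1) l by unfold_locales
  show ?thesis
    unfolding k diff_Suc_1 separable_iff_alternating weave_column_iff weave_iff_alternating
    by simp
qed

end
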